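(* Let $0<r<1$ and suppose $g$ is a complex-valued function that is analytic and nonvanishing in a neighborhood of the closed disc $\{z\in\mathbb{C}: |z|\le r\}$. Then for all $\varepsilon>0$ and $\delta>0$ there exist a constant $c_B\in\mathbb{C}$ and a Blaschke product $B$ having all its zeros on the circle $\{z:|z|=r\}$ such that $$\left|g(z)-c_B B(z)\right|<\varepsilon \quad\text{for all } z \text{ with } |z|<r-\delta.$$
   Context: Let $\mathbb{D}=\{z\in\mathbb{C}:|z|<1\}$. A Blaschke product is a function on $\mathbb{D}$ of the form $B(z)=\lambda z^n\prod_{j}\frac{-\overline{a_j}}{|a_j|}\frac{z-a_j}{1-\overline{a_j}z}$, where $n$ is a nonnegative integer, $|\lambda|=1$, $0<|a_j|<1$, the (finite or countably infinite) family $(a_j)$ satisfies $\sum_j(1-|a_j|)<\infty$. It is a finite Blaschke product if there are finitely many $a_j$; equivalently $B(z)=\lambda\prod_{j=1}^N\frac{z-a_j}{1-\overline{a_j}z}$ with $|a_j|<1$, $|\lambda|=1$. *)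

theory Defs
  imports "HOL-Complex_Analysis.Complex_Analysis"
begin

definition blaschke_factor :: "complex \<Rightarrow> complex \<Rightarrow> complex" where
  "blaschke_factor a z =
     (- cnj a / complex_of_real (norm a)) * ((z - a) / (1 - cnj a * z))"

(* The index set J \<subseteq> \<nat> may be finite (possibly empty) or infinite, so that finite and
   countably infinite families are treated uniformly; indices outside J contribute the
   factor 1.  The family need not be injective, so zeros may be repeated.  A Blaschke product
   is a function on the unit disc: values of B outside the disc are irrelevant. *)
definition is_blaschke_product :: "(complex \<Rightarrow> complex) \<Rightarrow> bool" where
  "is_blaschke_product B \<longleftrightarrow>
     (\<exists>(c :: complex) (n :: nat) (J :: nat set) (a :: nat \<Rightarrow> complex).
        norm c = 1 \<and>
        (\<forall>j\<in>J. 0 < norm (a j) \<and> norm (a j) < 1) \<and>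
        (\<lambda>j. 1 - norm (a j)) summable_on J \<and>
        (\<forall>z\<in>ball 0 1.
           B z = c * z ^ n * (\<Prod>j. if j \<in> J then blaschke_factor (a j) z else 1)))"

end

theory Submission
  imports Defs "HOL-Computational_Algebra.Fundamental_Theorem_Algebra"
begin

text \<open>
  A Blaschke product whose zeros are \<open>r \<zeta>\<^sub>j\<close> with \<open>norm \<zeta>\<^sub>j = 1\<close> is, up to a constant factor,
  \<open>p (z / r) / p (r z)\<close> with \<open>p w = (\<Prod>j. w - \<zeta>\<^sub>j)\<close>, since \<open>1 - cnj (r \<zeta>\<^sub>j) z\<close> is a unimodular multiple
  of \<open>r z - \<zeta>\<^sub>j\<close>.
  Polynomials with all roots on the unit circle approximate, locally uniformly in the unit disc, every
  zero-free function \<open>E\<close> analytic near the closed disc: if \<open>A\<close> is a zero-free Taylor polynomial of \<open>E\<close>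
  and \<open>A*\<close> its reflection in the circle, then \<open>norm A*\<close> is at most \<open>norm A\<close> inside the circle and at
  least \<open>norm A\<close> outside, so \<open>A + w ^ N A*\<close> vanishes only on the circle and tends to \<open>A\<close> inside.
  It remains to write \<open>g\<close> approximately as \<open>c E (z / r) / E (r z)\<close>. Approximate a logarithm of \<open>g\<close> by
  a polynomial \<open>P\<close> and take \<open>E = exp Q\<close>, where \<open>Q (z / r) - Q (r z) = P z - P 0\<close> is solved
  coefficientwise.
\<close>

section \<open>Uniform polynomial approximation on closed discs\<close>

lemma holomorphic_uniform_poly_approx:
  fixes f :: "complex \<Rightarrow> complex"
  assumes f: "f holomorphic_on ball 0 R" and "0 \<le> s" "s < R" "0 < e"
  shows "\<exists>p. \<forall>z\<in>cball 0 s. norm (poly p z - f z) < e"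
proof -
  define a where "a n = (deriv ^^ n) f 0 / fact n" for n
  have sums: "(\<lambda>n. a n * z ^ n) sums f z" if "norm z < R" for z
    using holomorphic_power_series[OF f, of z] that by (simp add: a_def)
  \<comment> \<open>Convergence of the Taylor series at a point of modulus strictly between
    \<open>s\<close> and \<open>R\<close> pushes the radius of convergence above \<open>s\<close>,
    whence uniform convergence on \<open>cball 0 s\<close>.\<close>
  define w where "w = complex_of_real ((s + R) / 2)"
  have nw: "norm w = (s + R) / 2"
    unfolding w_def norm_of_real using assms by simp
  have "summable (\<lambda>n. a n * w ^ n)"
    using sums[of w] nw assms by (simp add: sums_iff)
  then have "ereal (norm w) \<le> conv_radius a"
    by (rule conv_radius_geI)
  moreover have "ereal s < ereal (norm w)"
    using nw assms by simp
  ultimately have "ereal s < conv_radius a"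
    by (rule less_le_trans[rotated])
  from powser_uniform_limit[OF this, of 0]
  have "\<forall>\<^sub>F n in sequentially. \<forall>z\<in>cball 0 s.
          dist (\<Sum>i<n. a i * (z - 0) ^ i) (\<Sum>i. a i * (z - 0) ^ i) < e"
    using \<open>0 < e\<close> by (rule uniform_limitD)
  then obtain n where n: "\<forall>z\<in>cball 0 s. dist (\<Sum>i<n. a i * z ^ i) (\<Sum>i. a i * z ^ i) < e"
    by (auto simp: eventually_sequentially)
  have "norm (poly (\<Sum>i<n. monom (a i) i) z - f z) < e" if "z \<in> cball 0 s" for z
  proof -
    have "(\<Sum>i. a i * z ^ i) = f z"
      using sums[of z] that assms by (auto simp: sums_iff)
    with n[rule_format, OF that] show ?thesis
      by (simp add: poly_sum poly_monom dist_norm)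
  qed
  then show ?thesis by blast
qed

section \<open>Polynomials with all roots on the unit circle\<close>

lemma norm_reflected_factor:
  fixes b z :: complex
  shows "(norm (1 - cnj b * z))\<^sup>2 - (norm (z - b))\<^sup>2 = ((norm b)\<^sup>2 - 1) * ((norm z)\<^sup>2 - 1)"
  unfolding cmod_power2 by (simp add: algebra_simps power2_eq_square)

text \<open>Each factor \<open>z - b\<close> is replaced by \<open>1 - cnj b * z\<close>, of equal
  modulus on the unit circle. Every root \<open>b\<close> of \<open>A\<close> has modulus above 1,
  so by \<open>norm_reflected_factor\<close> the sign of \<open>(norm z)^2 - 1\<close> decides which
  of the two factors is larger. The zeros \<open>1 / cnj b\<close> of \<open>q\<close> lie inside
  the circle.\<close>

lemma poly_reflection:
  fixes A :: "complex poly"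
  assumes A: "\<And>z. norm z \<le> 1 \<Longrightarrow> poly A z \<noteq> 0"
  obtains q where "\<And>z. norm z \<le> 1 \<Longrightarrow> norm (poly q z) \<le> norm (poly A z)"
    and "\<And>z. norm z \<ge> 1 \<Longrightarrow> norm (poly A z) \<le> norm (poly q z)"
    and "\<And>z. norm z \<ge> 1 \<Longrightarrow> poly q z \<noteq> 0"
proof -
  obtain b where b: "smult (lead_coeff A) (\<Prod>i<degree A. [:-b i, 1:]) = A"
    by (rule complex_poly_decompose')
  define q where "q = smult (lead_coeff A) (\<Prod>i<degree A. [:1, -cnj (b i):])"
  have Az: "poly A z = lead_coeff A * (\<Prod>i<degree A. z - b i)" for z
    by (subst b[symmetric]) (simp add: poly_prod)
  have qz: "poly q z = lead_coeff A * (\<Prod>i<degree A. 1 - cnj (b i) * z)" for z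
    by (simp add: q_def poly_prod mult.commute)
  have lc: "lead_coeff A \<noteq> 0"
    using A[of 0] by auto
  have nb: "norm (b i) > 1" if "i < degree A" for i
  proof (rule ccontr)
    assume "\<not> norm (b i) > 1"
    then have "poly A (b i) \<noteq> 0"
      using A by simp
    moreover have "poly A (b i) = 0"
      unfolding Az using that by auto
    ultimately show False by simp
  qed
  have nb2: "(norm (b i))\<^sup>2 - 1 > 0" if "i < degree A" for i
    using nb[OF that] by (simp add: one_less_power)
  show ?thesis
  proof (rule that[of q])
    fix z :: complex
    assume z: "norm z \<le> 1"
    have "norm (1 - cnj (b i) * z) \<le> norm (z - b i)" if "i < degree A" for i
    proof (rule power2_le_imp_le)
      have "((norm (b i))\<^sup>2 - 1) * ((norm z)\<^sup>2 - 1) \<le> 0"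
        using nb2[OF that] z by (intro mult_nonneg_nonpos) (auto simp: power_le_one)
      then show "(norm (1 - cnj (b i) * z))\<^sup>2 \<le> (norm (z - b i))\<^sup>2"
        using norm_reflected_factor[of "b i" z] by linarith
    qed simp
    then show "norm (poly q z) \<le> norm (poly A z)"
      unfolding Az qz norm_mult prod_norm[symmetric]
      by (intro mult_left_mono prod_mono) auto
  next
    fix z :: complex
    assume z: "norm z \<ge> 1"
    have "norm (z - b i) \<le> norm (1 - cnj (b i) * z)" if "i < degree A" for i
    proof (rule power2_le_imp_le)
      have "((norm (b i))\<^sup>2 - 1) * ((norm z)\<^sup>2 - 1) \<ge> 0"
        using nb2[OF that] z by (intro mult_nonneg_nonneg) (auto simp: one_le_power)
      then show "(norm (z - b i))\<^sup>2 \<le> (norm (1 - cnj (b i) * z))\<^sup>2"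
        using norm_reflected_factor[of "b i" z] by linarith
    qed simp
    then show "norm (poly A z) \<le> norm (poly q z)"
      unfolding Az qz norm_mult prod_norm[symmetric]
      by (intro mult_left_mono prod_mono) auto
    have "1 - cnj (b i) * z \<noteq> 0" if "i < degree A" for i
    proof
      assume "1 - cnj (b i) * z = 0"
      then have "norm (cnj (b i) * z) = 1"
        by (metis eq_iff_diff_eq_0 norm_one)
      moreover have "1 < norm (b i) * norm z"
        using nb[OF that] z by (rule less_1_mult'[of _ _])
      ultimately show False
        by (simp add: norm_mult)
    qed
    with lc show "poly q z \<noteq> 0"
      unfolding qz by auto
  qed
qed

text \<open>At a zero of \<open>A + z ^ Suc N * q\<close> the two summands have equal modulus. Off
  the circle the power of \<open>z\<close> makes the comparison of \<open>q\<close> with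
  \<open>A\<close> strict, in opposite directions inside and outside, so equality is possible only
  on the circle.\<close>

lemma poly_unimodular_roots_approx_poly:
  fixes A :: "complex poly"
  assumes A: "\<And>z. norm z \<le> 1 \<Longrightarrow> poly A z \<noteq> 0"
  obtains p where "p \<noteq> 0" and "\<And>z. poly p z = 0 \<Longrightarrow> norm z = 1"
    and "\<And>z. norm z \<le> 1 \<Longrightarrow> norm (poly p z - poly A z) \<le> norm z ^ Suc N * norm (poly A z)"
proof -
  obtain q where q: "\<And>z. norm z \<le> 1 \<Longrightarrow> norm (poly q z) \<le> norm (poly A z)"
    "\<And>z. norm z \<ge> 1 \<Longrightarrow> norm (poly A z) \<le> norm (poly q z)"
    "\<And>z. norm z \<ge> 1 \<Longrightarrow> poly q z \<noteq> 0"
    using poly_reflection[OF A] by metis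
  \<comment> \<open>The exponent must be positive: this gives the strict inequalities and
    \<open>poly p 0 = poly A 0\<close>.\<close>
  define p where "p = A + monom 1 (Suc N) * q"
  have pz: "poly p z = poly A z + z ^ Suc N * poly q z" for z
    by (simp add: p_def poly_monom)
  show ?thesis
  proof (rule that[of p])
    have "poly p 0 \<noteq> 0"
      using A[of 0] by (simp add: pz)
    then show "p \<noteq> 0" by auto
  next
    fix z
    assume "poly p z = 0"
    then have eq: "norm (poly A z) = norm z ^ Suc N * norm (poly q z)"
      unfolding pz by (metis add_eq_0_iff2 norm_minus_cancel norm_mult norm_power)
    show "norm z = 1"
    proof (rule linorder_cases[of "norm z" 1])
      assume z: "norm z < 1"
      have "norm z ^ Suc N * norm (poly q z) \<le> norm z ^ Suc N * norm (poly A z)"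
        using q(1)[of z] z by (intro mult_left_mono) auto
      also have "\<dots> < 1 * norm (poly A z)"
        using z A[of z] by (intro mult_strict_right_mono) (auto simp: power_less_one_iff simp del: power_Suc)
      finally show ?thesis using eq by simp
    next
      assume z: "norm z > 1"
      have "1 * norm (poly q z) < norm z ^ Suc N * norm (poly q z)"
        using z q(3)[of z] by (intro mult_strict_right_mono one_less_power) auto
      with eq q(2)[of z] z show ?thesis by simp
    qed
  next
    fix z :: complex
    assume "norm z \<le> 1"
    then show "norm (poly p z - poly A z) \<le> norm z ^ Suc N * norm (poly A z)"
      unfolding pz using q(1)[of z]
      by (auto simp: norm_mult norm_power intro!: mult_left_mono)
  qed
qed

lemma poly_unimodular_roots_approx:
  fixes E :: "complex \<Rightarrow> complex"
  assumes E: "E holomorphic_on ball 0 R" and "1 < R"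
    and nz: "\<And>z. norm z \<le> 1 \<Longrightarrow> E z \<noteq> 0"
    and s: "0 \<le> s" "s < 1" and "0 < e"
  shows "\<exists>p. p \<noteq> 0 \<and> (\<forall>z. poly p z = 0 \<longrightarrow> norm z = 1) \<and>
             (\<forall>z\<in>cball 0 s. norm (poly p z - E z) < e)"
proof -
  have cont: "continuous_on (cball 0 1) (\<lambda>z. norm (E z))"
    using E \<open>1 < R\<close>
    by (intro continuous_on_norm holomorphic_on_imp_continuous_on holomorphic_on_subset[OF E]) auto
  obtain x where x: "x \<in> cball 0 1" "\<And>z. z \<in> cball 0 1 \<Longrightarrow> norm (E x) \<le> norm (E z)"
    using continuous_attains_inf[OF _ _ cont] by auto
  obtain y where y: "\<And>z. z \<in> cball 0 1 \<Longrightarrow> norm (E z) \<le> norm (E y)"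
    using continuous_attains_sup[OF _ _ cont] by force
  \<comment> \<open>The minimum of \<open>norm (E z)\<close> keeps \<open>A\<close> zero-free on the
    closed disc, \<open>e / 2\<close> is half of the error, and 1 yields the bound \<open>M\<close>
    on \<open>A\<close>.\<close>
  define d where "d = min (norm (E x)) (min (e / 2) 1)"
  have d: "0 < d" "d \<le> norm (E x)" "d \<le> e / 2" "d \<le> 1"
    using nz[of x] x(1) \<open>0 < e\<close> by (auto simp: d_def)
  obtain A where A: "\<And>z. norm z \<le> 1 \<Longrightarrow> norm (poly A z - E z) < d"
    using holomorphic_uniform_poly_approx[OF E _ \<open>1 < R\<close> d(1)] by force
  have A0: "poly A z \<noteq> 0" if "norm z \<le> 1" for z
  proof
    assume "poly A z = 0"
    with A[OF that] have "norm (E z) < d" by simp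
    with x(2)[of z] d(2) that show False by simp
  qed
  define M where "M = norm (E y) + 1"
  have M: "norm (poly A z) \<le> M" if "norm z \<le> 1" for z
    using A[OF that] y[of z] that d(4) norm_triangle_sub[of "poly A z" "E z"]
    by (simp add: M_def)
  have "0 < M" unfolding M_def by (smt (verit) norm_ge_zero)
  have "(\<lambda>N. s ^ N * M) \<longlonglongrightarrow> 0 * M"
    using s by (intro tendsto_mult LIMSEQ_realpow_zero tendsto_const)
  then have "\<forall>\<^sub>F N in sequentially. s ^ N * M < e / 2"
    using \<open>0 < e\<close> by (intro order_tendstoD(2)[of _ "0 * M"]) auto
  then obtain N where "\<forall>n\<ge>N. s ^ n * M < e / 2"
    by (auto simp: eventually_sequentially)
  then have N: "s ^ Suc N * M < e / 2"
    using le_Suc_eq by blast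
  obtain p where p: "p \<noteq> 0" "\<And>z. poly p z = 0 \<Longrightarrow> norm z = 1"
    "\<And>z. norm z \<le> 1 \<Longrightarrow> norm (poly p z - poly A z) \<le> norm z ^ Suc N * norm (poly A z)"
    using poly_unimodular_roots_approx_poly[OF A0, of N] by metis
  have "norm (poly p z - E z) < e" if "z \<in> cball 0 s" for z
  proof -
    have z: "norm z \<le> s" "norm z \<le> 1"
      using that s by auto
    have "norm (poly p z - poly A z) \<le> norm z ^ Suc N * norm (poly A z)"
      using p(3) z by blast
    also have "\<dots> \<le> s ^ Suc N * M"
      using z M s by (intro mult_mono power_mono) auto
    finally have "norm (poly p z - poly A z) < e / 2"
      using N by linarith
    moreover have "norm (poly A z - E z) < e / 2"
      using A[OF z(2)] d(3) by linarith
    ultimately show ?thesis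
      by (rule norm_diff_triangle_less[THEN less_le_trans]) simp
  qed
  with p(1,2) show ?thesis by blast
qed

section \<open>The scaling equation for polynomials\<close>

lemma poly_scaling_difference:
  fixes P :: "complex poly"
  assumes "0 < r" "r < (1::real)"
  shows "\<exists>Q. \<forall>z. poly Q (z / of_real r) - poly Q (of_real r * z) = poly P z - poly P 0"
proof -
  \<comment> \<open>Comparing coefficients requires
    \<open>c i * (1 / r ^ i - r ^ i) = coeff P i\<close> for positive \<open>i\<close>. For
    \<open>i = 0\<close> the quotient is 0 by convention; any value would do, since constant terms
    cancel on both sides.\<close>
  define c where "c i = coeff P i * of_real (r ^ i / (1 - r ^ (2 * i)))" for i
  define Q where "Q = (\<Sum>i\<le>degree P. monom (c i) i)"
  have coeff_eq: "c i * (z / of_real r) ^ i - c i * (of_real r * z) ^ i =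
      coeff P i * z ^ i - coeff P i * 0 ^ i" for i z
  proof (cases "i = 0")
    case False
    define y where "y = r ^ i"
    have "r ^ (2 * i) < 1"
      using assms False by (intro power_less_one_iff[THEN iffD2]) auto
    moreover have y2: "r ^ (2 * i) = y * y"
      by (simp add: y_def mult_2 power_add)
    moreover have "y \<noteq> 0"
      using assms by (simp add: y_def)
    ultimately have "y / (1 - y * y) * (1 / y - y) = 1"
      by (simp add: field_simps)
    then have "r ^ i / (1 - r ^ (2 * i)) * (1 / r ^ i - r ^ i) = 1"
      by (simp only: y2 flip: y_def)
    then have "complex_of_real (r ^ i / (1 - r ^ (2 * i)) * (1 / r ^ i - r ^ i)) = 1"
      by (simp only: of_real_1)
    moreover define k where "k = complex_of_real (r ^ i / (1 - r ^ (2 * i)))"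
    ultimately have k: "k * (1 / of_real r ^ i - of_real r ^ i) = 1"
      by simp
    have "c i * (z / of_real r) ^ i - c i * (of_real r * z) ^ i =
      coeff P i * z ^ i * (k * (1 / of_real r ^ i - of_real r ^ i))"
      unfolding c_def k_def[symmetric] by (simp add: power_divide power_mult_distrib algebra_simps)
    then show ?thesis
      unfolding k using False by (simp add: power_0_left)
  qed simp
  have "poly Q (z / of_real r) - poly Q (of_real r * z) = poly P z - poly P 0" for z
    unfolding Q_def poly_sum poly_monom poly_altdef[of P] sum_subtractf[symmetric] coeff_eq ..
  then show ?thesis by blast
qed

section \<open>Blaschke products with zeros on a circle\<close>

lemma blaschke_factor_circle:
  assumes "0 < r" and \<zeta>: "norm \<zeta> = 1"
  shows "blaschke_factor (of_real r * \<zeta>) z = of_real r * ((z / of_real r - \<zeta>) / (of_real r * z - \<zeta>))"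
proof -
  have u: "\<zeta> * cnj \<zeta> = 1"
    using \<zeta> by (simp add: complex_norm_square[symmetric])
  have "cnj \<zeta> \<noteq> 0" using \<zeta> by auto
  \<comment> \<open>The factor \<open>- cnj \<zeta>\<close> split off here cancels the normalising
    constant of the Blaschke factor. The resulting identity holds even where the denominator
    vanishes, both sides then being 0.\<close>
  have "1 - cnj (of_real r * \<zeta>) * z = (- cnj \<zeta>) * (of_real r * z - \<zeta>)"
    using u by (simp add: algebra_simps)
  moreover have "- cnj (of_real r * \<zeta>) / of_real (norm (of_real r * \<zeta>)) = - cnj \<zeta>"
    using assms by (simp add: norm_mult)
  moreover have "z - of_real r * \<zeta> = of_real r * (z / of_real r - \<zeta>)"
    using assms by (simp add: algebra_simps)
  ultimately show ?thesis
    unfolding blaschke_factor_def using \<open>cnj \<zeta> \<noteq> 0\<close> by simp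
qed

text \<open>The zeros are \<open>r\<close> times the roots of \<open>p\<close>, listed with
  multiplicity. The leading coefficient cancels in the quotient, and each Blaschke factor
  contributes one factor \<open>r\<close>.\<close>

lemma is_blaschke_product_poly_quotient:
  fixes p :: "complex poly"
  assumes r: "0 < r" "r < 1" and "p \<noteq> 0" and roots: "\<And>z. poly p z = 0 \<Longrightarrow> norm z = 1"
  shows "is_blaschke_product
           (\<lambda>z. of_real r ^ degree p * (poly p (z / of_real r) / poly p (of_real r * z)))"
proof -
  obtain \<zeta> where \<zeta>: "smult (lead_coeff p) (\<Prod>i<degree p. [:-\<zeta> i, 1:]) = p"
    by (rule complex_poly_decompose')
  have pz: "poly p z = lead_coeff p * (\<Prod>i<degree p. z - \<zeta> i)" for z
    by (subst \<zeta>[symmetric]) (simp add: poly_prod)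
  have n\<zeta>: "norm (\<zeta> i) = 1" if "i < degree p" for i
    by (rule roots) (use that in \<open>auto simp: pz\<close>)
  define a where "a i = of_real r * \<zeta> i" for i
  have na: "norm (a i) = r" if "i < degree p" for i
    using n\<zeta>[OF that] r by (simp add: a_def norm_mult)
  have "of_real r ^ degree p * (poly p (z / of_real r) / poly p (of_real r * z)) =
      1 * z ^ 0 * (\<Prod>j. if j \<in> {..<degree p} then blaschke_factor (a j) z else 1)" for z
  proof -
    have "(\<Prod>j. if j \<in> {..<degree p} then blaschke_factor (a j) z else 1) =
        (\<Prod>j<degree p. if j \<in> {..<degree p} then blaschke_factor (a j) z else 1)"
      by (rule prodinf_finite) auto
    also have "\<dots> = (\<Prod>j<degree p. of_real r * ((z / of_real r - \<zeta> j) / (of_real r * z - \<zeta> j)))"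
      by (rule prod.cong) (auto simp: a_def blaschke_factor_circle r n\<zeta>)
    also have "\<dots> = of_real r ^ degree p * (poly p (z / of_real r) / poly p (of_real r * z))"
      using \<open>p \<noteq> 0\<close> by (simp add: pz prod.distrib prod_dividef)
    finally show ?thesis by simp
  qed
  then show ?thesis
    unfolding is_blaschke_product_def using na r
    by (intro exI[of _ 1] exI[of _ 0] exI[of _ "{..<degree p}"] exI[of _ a]) auto
qed

section \<open>Polynomial logarithms and the approximation of \<open>g\<close>\<close>

lemma exp_poly_approx:
  fixes h :: "complex \<Rightarrow> complex"
  assumes h: "h holomorphic_on ball 0 R" and s: "0 \<le> s" "s < R" and "0 < e"
  shows "\<exists>P. \<forall>z\<in>cball 0 s. norm (exp (poly P z) - exp (h z)) < e"
proof -
  have "compact (h ` cball 0 s)"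
    using s by (intro compact_continuous_image holomorphic_on_imp_continuous_on
        holomorphic_on_subset[OF h]) auto
  then obtain C where C: "\<And>z. z \<in> cball 0 s \<Longrightarrow> norm (h z) \<le> C"
    by (force dest!: compact_imp_bounded simp: bounded_iff)
  \<comment> \<open>The radius \<open>C + 1\<close> also covers the values of \<open>P\<close>,
    which stay within 1 of those of \<open>h\<close>.\<close>
  have "uniformly_continuous_on (cball 0 (C + 1)) (exp :: complex \<Rightarrow> complex)"
    by (intro compact_uniformly_continuous continuous_intros) auto
  then obtain d where d: "0 < d" "\<And>u v. u \<in> cball 0 (C + 1) \<Longrightarrow> v \<in> cball 0 (C + 1) \<Longrightarrow>
      dist u v < d \<Longrightarrow> dist (exp u) (exp v :: complex) < e"
    using \<open>0 < e\<close> unfolding uniformly_continuous_on_def by metis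
  obtain P where P: "\<And>z. z \<in> cball 0 s \<Longrightarrow> norm (poly P z - h z) < min d 1"
    using holomorphic_uniform_poly_approx[OF h s, of "min d 1"] d(1) by force
  have "norm (exp (poly P z) - exp (h z)) < e" if z: "z \<in> cball 0 s" for z
    unfolding dist_norm[symmetric]
    using C[OF z] P[OF z] norm_triangle_sub[of "poly P z" "h z"]
    by (intro d(2)) (auto simp: dist_norm)
  then show ?thesis by blast
qed

theorem corollary2p3:
  fixes r :: real and g :: "complex \<Rightarrow> complex" and U :: "complex set"
  assumes "0 < r" and "r < 1"
    and "open U" and "cball 0 r \<subseteq> U"
    and "g holomorphic_on U" and "\<forall>z\<in>U. g z \<noteq> 0"
  shows "\<forall>\<epsilon>>0. \<forall>\<delta>>0. \<exists>(c_B :: complex) (B :: complex \<Rightarrow> complex).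
           is_blaschke_product B \<and>
           (\<forall>z\<in>ball 0 1. B z = 0 \<longrightarrow> norm z = r) \<and>
           (\<forall>z. norm z < r - \<delta> \<longrightarrow> norm (g z - c_B * B z) < \<epsilon>)"
proof (intro allI impI)
  fix \<epsilon> \<delta> :: real
  assume "0 < \<epsilon>" "0 < \<delta>"
  \<comment> \<open>As \<open>r - \<delta>\<close> may be negative, the maximum with
    \<open>r / 2\<close> keeps \<open>s\<close> positive and still below \<open>r\<close>.\<close>
  define s where "s = max (r - \<delta>) (r / 2)"
  have s: "0 < s" "s < r" "r - \<delta> \<le> s"
    using \<open>0 < \<delta>\<close> \<open>0 < r\<close> by (auto simp: s_def)
  have sub: "ball 0 r \<subseteq> U" using assms(4) by auto
  obtain h where h: "h holomorphic_on ball 0 r" "\<And>z. z \<in> ball 0 r \<Longrightarrow> exp (h z) = g z"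
    by (rule holomorphic_logarithm_exists[of "ball 0 r" g 0])
       (use sub assms in \<open>auto intro: holomorphic_on_subset\<close>)
  obtain P where P: "\<And>z. z \<in> cball 0 s \<Longrightarrow> norm (exp (poly P z) - exp (h z)) < \<epsilon> / 2"
    using exp_poly_approx[OF h(1), of s "\<epsilon> / 2"] s \<open>0 < \<epsilon>\<close>
    by force
  obtain Q where Q: "\<And>z. poly Q (z / of_real r) - poly Q (of_real r * z) = poly P z - poly P 0"
    using poly_scaling_difference[OF assms(1,2), of P] by auto
  define E where "E z = exp (poly Q z)" for z
  have E_holo: "E holomorphic_on S" for S
    unfolding E_def by (intro holomorphic_intros)
  \<comment> \<open>The radius \<open>s / r\<close> is below 1, and \<open>cball 0 (s / r)\<close>
    contains both \<open>z / r\<close> and \<open>r * z\<close> for every \<open>z\<close> in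
    \<open>cball 0 s\<close>.\<close>
  have "\<exists>p. p \<noteq> 0 \<and> (\<forall>z. poly p z = 0 \<longrightarrow> norm z = 1) \<and>
      (\<forall>z\<in>cball 0 (s / r). norm (poly p z - E z) < inverse (real (Suc n)))" for n
    using s assms(1) by (intro poly_unimodular_roots_approx[of E 2] E_holo) (auto simp: E_def)
  then obtain p where p: "\<And>n. p n \<noteq> 0" "\<And>n z. poly (p n) z = 0 \<Longrightarrow> norm z = 1"
    "\<And>n z. z \<in> cball 0 (s / r) \<Longrightarrow> norm (poly (p n) z - E z) < inverse (real (Suc n))"
    by metis
  have lim: "uniform_limit (cball 0 (s / r)) (\<lambda>n. poly (p n)) E sequentially"
  proof (rule uniform_limitI)
    fix e :: real
    assume "0 < e"
    with LIMSEQ_inverse_real_of_nat have "\<forall>\<^sub>F n in sequentially. inverse (real (Suc n)) < e"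
      by (rule order_tendstoD)
    then show "\<forall>\<^sub>F n in sequentially. \<forall>z\<in>cball 0 (s / r). dist (poly (p n) z) (E z) < e"
    proof eventually_elim
      case (elim n)
      show ?case
        unfolding dist_norm using p(3) elim less_trans by blast
    qed
  qed
  have in1: "(\<lambda>z::complex. z / of_real r) \<in> cball 0 s \<rightarrow> cball 0 (s / r)"
    using assms(1) by (auto simp: norm_divide divide_right_mono)
  have in2: "(\<lambda>z::complex. of_real r * z) \<in> cball 0 s \<rightarrow> cball 0 (s / r)"
  proof
    fix z :: complex
    assume "z \<in> cball 0 s"
    then have "r * norm z \<le> 1 * s"
      using assms(1,2) by (intro mult_mono) auto
    also have "1 * s \<le> s / r"
      using assms(1,2) s by (simp add: field_simps)
    finally show "of_real r * z \<in> cball 0 (s / r)"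
      using assms(1) by (simp add: norm_mult)
  qed
  have cont1: "continuous_on (cball 0 s) (\<lambda>z. E (z / of_real r))"
    and cont2: "continuous_on (cball 0 s) (\<lambda>z. norm (E (of_real r * z)))"
    unfolding E_def using assms(1) by (auto intro!: continuous_intros)
  \<comment> \<open>A positive lower bound for the limit of the denominators, needed for uniform
    convergence of the quotients.\<close>
  obtain x where x: "\<And>z. z \<in> cball 0 s \<Longrightarrow> norm (E (of_real r * x)) \<le> norm (E (of_real r * z))"
    using continuous_attains_inf[OF _ _ cont2] s by force
  have "uniform_limit (cball 0 s)
      (\<lambda>n z. poly (p n) (z / of_real r) / poly (p n) (of_real r * z))
      (\<lambda>z. E (z / of_real r) / E (of_real r * z)) sequentially"
    by (intro uniform_lim_divide[where b = "norm (E (of_real r * x))"] uniform_limit_compose'[OF lim in1] uniform_limit_compose'[OF lim in2]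
        compact_imp_bounded compact_continuous_image cont1 x) (auto simp: E_def)
  moreover have "0 < \<epsilon> / 2 / norm (exp (poly P 0))"
    using \<open>0 < \<epsilon>\<close> by simp
  ultimately have "\<forall>\<^sub>F n in sequentially. \<forall>z\<in>cball 0 s.
      dist (poly (p n) (z / of_real r) / poly (p n) (of_real r * z)) (E (z / of_real r) / E (of_real r * z))
        < \<epsilon> / 2 / norm (exp (poly P 0))"
    by (rule uniform_limitD)
  then obtain n where n: "\<And>z. z \<in> cball 0 s \<Longrightarrow>
      norm (poly (p n) (z / of_real r) / poly (p n) (of_real r * z) - E (z / of_real r) / E (of_real r * z))
        < \<epsilon> / 2 / norm (exp (poly P 0))"
    unfolding dist_norm eventually_sequentially by (meson le_refl)
  define B where "B z = of_real r ^ degree (p n) *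
    (poly (p n) (z / of_real r) / poly (p n) (of_real r * z))" for z
  \<comment> \<open>This cancels the power of \<open>r\<close> in \<open>B\<close> and restores the
    factor \<open>exp (poly P 0)\<close> removed by the scaling equation.\<close>
  define c where "c = exp (poly P 0) / of_real r ^ degree (p n)"
  have "is_blaschke_product B"
    unfolding B_def using assms(1,2) p by (intro is_blaschke_product_poly_quotient) auto
  moreover have "norm z = r" if z: "z \<in> ball 0 1" and "B z = 0" for z
  proof -
    \<comment> \<open>The denominator has no zero in the unit disc, so no zero of \<open>B\<close>
      there comes from division by 0.\<close>
    have "r * norm z < 1 * 1"
      using z assms(1,2) by (intro mult_strict_mono) auto
    then have "poly (p n) (of_real r * z) \<noteq> 0"
      using p(2)[of n "of_real r * z"] assms(1) by (auto simp: norm_mult)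
    with \<open>B z = 0\<close> have "poly (p n) (z / of_real r) = 0"
      using assms(1) by (auto simp: B_def)
    from p(2)[OF this] show ?thesis
      using assms(1) by (simp add: norm_divide field_simps)
  qed
  moreover have "norm (g z - c * B z) < \<epsilon>" if "norm z < r - \<delta>" for z
  proof -
    have z: "z \<in> cball 0 s" "z \<in> ball 0 r"
      using that s by auto
    let ?q = "poly (p n) (z / of_real r) / poly (p n) (of_real r * z)"
    have "E (z / of_real r) / E (of_real r * z) = exp (poly P z - poly P 0)"
      by (simp add: E_def Q flip: exp_diff)
    then have eP: "exp (poly P 0) * (E (z / of_real r) / E (of_real r * z)) = exp (poly P z)"
      by (simp add: exp_diff)
    have cB: "c * B z = exp (poly P 0) * ?q"
      using assms(1) by (simp add: c_def B_def)
    have "norm (c * B z - exp (poly P z)) =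
        norm (exp (poly P 0)) * norm (?q - E (z / of_real r) / E (of_real r * z))"
      unfolding cB eP[symmetric] by (simp only: right_diff_distrib[symmetric] norm_mult)
    also have "\<dots> < \<epsilon> / 2"
      using n[OF z(1)] by (simp add: pos_less_divide_eq mult.commute)
    finally have "norm (c * B z - exp (poly P z)) < \<epsilon> / 2" .
    moreover have "norm (exp (poly P z) - g z) < \<epsilon> / 2"
      using P[OF z(1)] h(2)[OF z(2)] by simp
    ultimately have "norm (c * B z - g z) < \<epsilon> / 2 + \<epsilon> / 2"
      by (rule norm_diff_triangle_less)
    then show ?thesis by (simp add: norm_minus_commute)
  qed
  ultimately show "\<exists>(c_B :: complex) (B :: complex \<Rightarrow> complex).
           is_blaschke_product B \<and>
           (\<forall>z\<in>ball 0 1. B z = 0 \<longrightarrow> norm z = r) \<and>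
           (\<forall>z. norm z < r - \<delta> \<longrightarrow> norm (g z - c_B * B z) < \<epsilon>)"
    by blast
qed

end
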